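(* For every integer $h\ge1$ there is a bijection between the set $DI_{2h}(4321)$ and the set $\mathscr{D}_h$ of Dyck paths of length $2h$. Hence $|DI_{2h}(4321)|=C_h$, where $C_h$ is the $h$-th Catalan number.
   Context: $DI_n$ is the set of fixed point free involutions in the symmetric group $S_n$. A permutation $\sigma\in S_n$ contains the pattern $\pi\in S_k$ if there are $1\le i_1<\dots<i_k\le n$ such that $(\sigma(i_1),\dots,\sigma(i_k))$ is order-isomorphic to $\pi$; otherwise $\sigma$ avoids $\pi$. $DI_n(\pi)$ denotes the set of elements of $DI_n$ avoiding $\pi$. A Dyck path of length $2h$ is a lattice path from $(0,0)$ to $(2h,0)$ never going below the $x$-axis, with steps $U=(1,1)$ and $D=(1,-1)$. *)

theory Defs
  imports "HOL-Combinatorics.Permutations"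
begin

definition DI :: "nat \<Rightarrow> (nat \<Rightarrow> nat) set" where
  "DI n = {\<sigma>. \<sigma> permutes {1..n} \<and> \<sigma> \<circ> \<sigma> = id \<and> (\<forall>i\<in>{1..n}. \<sigma> i \<noteq> i)}"

definition contains_pattern :: "nat \<Rightarrow> (nat \<Rightarrow> nat) \<Rightarrow> nat \<Rightarrow> (nat \<Rightarrow> nat) \<Rightarrow> bool" where
  "contains_pattern n \<sigma> k \<pi> \<longleftrightarrow>
     (\<exists>i :: nat \<Rightarrow> nat. strict_mono_on {1..k} i \<and> i ` {1..k} \<subseteq> {1..n} \<and>
        (\<forall>a\<in>{1..k}. \<forall>b\<in>{1..k}. \<sigma> (i a) < \<sigma> (i b) \<longleftrightarrow> \<pi> a < \<pi> b))"

text \<open>The permutation with one-line notation \<open>xs\<close>, extended by the identity outside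
  \<open>{1..length xs}\<close> as \<^const>\<open>permutes\<close> requires.\<close>

definition one_line :: "nat list \<Rightarrow> nat \<Rightarrow> nat" where
  "one_line xs i = (if i \<in> {1..length xs} then xs ! (i - 1) else i)"

definition DI_avoiding :: "nat \<Rightarrow> nat list \<Rightarrow> (nat \<Rightarrow> nat) set" where
  "DI_avoiding n p = {\<sigma> \<in> DI n. \<not> contains_pattern n \<sigma> (length p) (one_line p)}"

text \<open>A lattice path starting at the origin is encoded by its list of step vectors; the points it
  visits are the partial sums.\<close>

definition path_point :: "(int \<times> int) list \<Rightarrow> nat \<Rightarrow> int \<times> int" where
  "path_point w j = (\<Sum>s\<leftarrow>take j w. fst s, \<Sum>s\<leftarrow>take j w. snd s)"

definition dyck_paths :: "nat \<Rightarrow> (int \<times> int) list set" where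
  "dyck_paths h = {w. set w \<subseteq> {(1, 1), (1, -1)} \<and>
     path_point w (length w) = (2 * int h, 0) \<and>
     (\<forall>j\<le>length w. 0 \<le> snd (path_point w j))}"

definition catalan :: "nat \<Rightarrow> nat" where
  "catalan n = (2 * n choose n) div (n + 1)"

text \<open>The division in \<^const>\<open>catalan\<close> is exact.\<close>

lemma Suc_dvd_central_binomial: "n + 1 dvd (2 * n choose n)"
proof -
  have "Suc n * (2 * n choose Suc n) = n * (2 * n choose n)"
    using binomial_absorb_comp[of "2 * n" n] binomial_absorption[of n "2 * n"]
    by (cases n) (simp_all add: binomial_absorption)
  then have "Suc n dvd n * (2 * n choose n)"
    by (metis dvd_triv_left)
  moreover have "coprime (Suc n) n"
    by simp
  ultimately show ?thesis
    by (simp add: coprime_dvd_mult_right_iff)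
qed

lemma catalan_times: "(n + 1) * catalan n = (2 * n choose n)"
  unfolding catalan_def using Suc_dvd_central_binomial by (rule dvd_mult_div_cancel)

lemma one_line_4321_permutes: "one_line [4, 3, 2, 1] permutes {1..4}"
proof (rule bij_imp_permutes)
  have "{1..4::nat} = {1, 2, 3, 4}" by auto
  then show "bij_betw (one_line [4, 3, 2, 1]) {1..4} {1..4}"
    by (auto simp: bij_betw_def inj_on_def one_line_def nth_Cons split: nat.splits)
qed (auto simp: one_line_def)

end

theory Submission
  imports Defs "HOL-Library.Infinite_Set"
begin

text \<open>
  A fixed point free involution is a perfect matching of \<open>{1..n}\<close> by arcs: every point is either
  an opener (\<open>i < \<sigma> i\<close>) or a closer (\<open>\<sigma> i < i\<close>), and \<open>\<sigma>\<close> exchanges the two kinds.  Two nested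
  arcs \<open>i < j < \<sigma> j < \<sigma> i\<close> form the pattern 4321.  Conversely, if no arcs are nested, then \<open>\<sigma>\<close>
  increases on the openers and on the closers, so a decreasing subsequence has at most one entry
  of each kind.  Hence avoiding 4321 means that the matching is nonnesting
  (\<open>DI_avoiding_4321_eq\<close>).

  Writing an up step for each opener and a down step for each closer turns a nonnesting matching
  into a Dyck path: the partners of the closers up to \<open>j\<close> are openers up to \<open>j\<close>.  The matching can
  be recovered, because an increasing map is determined by its domain and its image.  Conversely,
  given a Dyck path, match the \<open>k\<close>-th up step with the \<open>k\<close>-th down step; the path staying above
  the axis says precisely that the former comes before the latter.

  Dyck paths are counted together with all ballot words, those words of \<open>u\<close> up and \<open>d\<close> down steps
  with at least as many up as down steps in each prefix.  Removing the last step gives a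
  recurrence of Pascal type, which is solved by the reflection formula
  \<open>(u + d choose u) - (u + d choose (u + 1))\<close>.
\<close>

section \<open>Counting ballot words\<close>

abbreviation up :: "int \<times> int" where "up \<equiv> (1, 1)"
abbreviation down :: "int \<times> int" where "down \<equiv> (1, -1)"

text \<open>The index \<open>j\<close> is unbounded because \<^const>\<open>take\<close> returns the whole word beyond its length;
  this makes the condition on prefixes split when a last step is removed.\<close>

definition ballot_words :: "nat \<Rightarrow> nat \<Rightarrow> (int \<times> int) list set" where
  "ballot_words u d = {w. set w \<subseteq> {up, down} \<and> count_list w up = u \<and> count_list w down = d \<and>
     (\<forall>j. count_list (take j w) down \<le> count_list (take j w) up)}"

lemma all_prefixes_snoc:
  "(\<forall>j. P (take j (w @ [x]))) \<longleftrightarrow> (\<forall>j. P (take j w)) \<and> P (w @ [x])"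
proof safe
  fix j assume all: "\<forall>j. P (take j (w @ [x]))"
  show "P (take j w)"
    using all[rule_format, of "min j (length w)"] by (simp add: min_def split: if_splits)
next
  assume "\<forall>j. P (take j (w @ [x]))"
  from this[rule_format, of "length (w @ [x])"] show "P (w @ [x])" by simp
next
  fix j assume "\<forall>j. P (take j w)" "P (w @ [x])"
  then show "P (take j (w @ [x]))"
    by (cases "j \<le> length w") auto
qed

lemma snoc_in_ballot_words_iff:
  "w @ [x] \<in> ballot_words u d \<longleftrightarrow> d \<le> u \<and>
     (x = up \<and> (\<exists>u'. u = Suc u' \<and> w \<in> ballot_words u' d) \<or>
      x = down \<and> (\<exists>d'. d = Suc d' \<and> w \<in> ballot_words u d'))"
  unfolding ballot_words_def mem_Collect_eq
    all_prefixes_snoc[where P = "\<lambda>v. count_list v down \<le> count_list v up"]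
  by auto

lemma ballot_words_Suc_Suc:
  assumes "d \<le> u"
  shows "ballot_words (Suc u) (Suc d) =
    (\<lambda>w. w @ [up]) ` ballot_words u (Suc d) \<union> (\<lambda>w. w @ [down]) ` ballot_words (Suc u) d"
    (is "?L = ?R")
proof (rule set_eqI)
  fix w
  show "w \<in> ?L \<longleftrightarrow> w \<in> ?R"
  proof (cases w rule: rev_cases)
    case Nil
    then show ?thesis by (auto simp: ballot_words_def)
  next
    case (snoc v x)
    then show ?thesis using assms by (auto simp: snoc_in_ballot_words_iff)
  qed
qed

lemma ballot_words_0: "ballot_words u 0 = {replicate u up}"
proof (rule set_eqI)
  fix w show "w \<in> ballot_words u 0 \<longleftrightarrow> w \<in> {replicate u up}"
  proof (induction w arbitrary: u rule: rev_induct)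
    case Nil
    then show ?case by (auto simp: ballot_words_def)
  next
    case (snoc x w)
    then show ?case
      by (cases u) (auto simp: snoc_in_ballot_words_iff replicate_append_same[symmetric])
  qed
qed

lemma ballot_words_empty:
  assumes "u < d"
  shows "ballot_words u d = {}"
proof -
  have False if "w \<in> ballot_words u d" for w
    using that assms unfolding ballot_words_def
    by (auto dest: spec[of _ "length w"])
  then show ?thesis by blast
qed

text \<open>The reflection formula for ballot words, with the negative term moved to the left.  It
  includes the case \<open>d = u + 1\<close>, where there are no words and the two binomial coefficients agree
  by symmetry: the recurrence reaches this case from the diagonal \<open>d = u\<close>.\<close>

lemma card_ballot_words:
  assumes "d \<le> Suc u"
  shows "finite (ballot_words u d) \<and>
    card (ballot_words u d) + (u + d choose Suc u) = (u + d choose u)"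
  using assms
proof (induction "u + d" arbitrary: u d rule: less_induct)
  case less
  show ?case
  proof (cases d)
    case 0
    then show ?thesis by (simp add: ballot_words_0)
  next
    case (Suc e)
    show ?thesis
    proof (cases "d = Suc u")
      case True
      then show ?thesis
        using binomial_symmetric[of "Suc u" "u + d"] by (simp add: ballot_words_empty)
    next
      case False
      then obtain v where v: "u = Suc v" "e \<le> v"
        using less.prems Suc by (cases u) auto
      have A: "finite (ballot_words v (Suc e)) \<and>
          card (ballot_words v (Suc e)) + (v + Suc e choose Suc v) = (v + Suc e choose v)"
        using less.hyps[of v "Suc e"] v Suc by simp
      have B: "finite (ballot_words (Suc v) e) \<and>
          card (ballot_words (Suc v) e) + (Suc v + e choose Suc (Suc v)) = (Suc v + e choose Suc v)"
        using less.hyps[of "Suc v" e] v Suc by simp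
      have "card (ballot_words u d) = card (ballot_words v (Suc e)) + card (ballot_words (Suc v) e)"
        unfolding Suc v(1) ballot_words_Suc_Suc[OF v(2)] using A B
        by (subst card_Un_disjoint) (auto simp: card_image inj_on_def)
      moreover have "finite (ballot_words u d)"
        unfolding Suc v(1) ballot_words_Suc_Suc[OF v(2)] using A B by simp
      ultimately show ?thesis using A B Suc v(1) by simp
    qed
  qed
qed

lemma sum_list_steps:
  assumes "set w \<subseteq> {up, down}"
  shows "sum_list (map fst w) = int (count_list w up + count_list w down)"
    and "sum_list (map snd w) = int (count_list w up) - int (count_list w down)"
  using assms by (induction w) auto

lemma dyck_paths_eq_ballot_words: "dyck_paths h = ballot_words h h"
proof -
  have prefixes: "(\<forall>j\<le>length w. P (take j w)) \<longleftrightarrow> (\<forall>j. P (take j w))"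
    for w :: "(int \<times> int) list" and P
    by (metis nle_le order.refl take_all)
  have pp: "path_point w j = (int (count_list (take j w) up + count_list (take j w) down),
      int (count_list (take j w) up) - int (count_list (take j w) down))"
    if "set w \<subseteq> {up, down}" for w j
  proof -
    have "set (take j w) \<subseteq> {up, down}" using that set_take_subset[of j w] by blast
    from sum_list_steps[OF this] show ?thesis by (simp add: path_point_def)
  qed
  show ?thesis
    unfolding dyck_paths_def ballot_words_def
      prefixes[where P = "\<lambda>v. count_list v down \<le> count_list v up", symmetric]
    by (rule Collect_cong) (auto simp: pp)
qed

lemma card_dyck_paths: "card (dyck_paths h) = catalan h"
proof -
  have reflection: "card (dyck_paths h) + (2 * h choose Suc h) = (2 * h choose h)"
    using card_ballot_words[of h h] by (simp add: dyck_paths_eq_ballot_words mult_2)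
  have "Suc h * (2 * h choose Suc h) = h * (2 * h choose h)"
    using binomial_absorb_comp[of "2 * h" h] binomial_absorption[of h "2 * h"] by auto
  then have "(h + 1) * card (dyck_paths h) + h * (2 * h choose h) = (h + 1) * (2 * h choose h)"
    using arg_cong[OF reflection, of "\<lambda>x. (h + 1) * x"] by (simp add: distrib_left)
  then have "(h + 1) * card (dyck_paths h) = (h + 1) * catalan h"
    unfolding catalan_times by (simp add: algebra_simps)
  then show ?thesis unfolding mult_cancel1 by simp
qed

section \<open>Avoiding 4321 and nonnesting matchings\<close>

text \<open>Arcs \<open>i < \<sigma> i\<close> and \<open>j < \<sigma> j\<close> with \<open>i < j\<close> are nested if \<open>\<sigma> j < \<sigma> i\<close>; equality is
  excluded by injectivity, so that no nesting means that \<open>\<sigma>\<close> increases on the openers.\<close>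

definition nonnesting :: "(nat \<Rightarrow> nat) \<Rightarrow> bool" where
  "nonnesting \<sigma> \<longleftrightarrow> strict_mono_on {i. i < \<sigma> i} \<sigma>"

lemma DI_D:
  assumes "\<sigma> \<in> DI n"
  shows "\<sigma> (\<sigma> i) = i" "\<sigma> i \<noteq> i \<longleftrightarrow> i \<in> {1..n}" "\<sigma> i \<in> {1..n} \<longleftrightarrow> i \<in> {1..n}"
  using assms permutes_in_image[of \<sigma> "{1..n}" i] permutes_not_in[of \<sigma> "{1..n}" i]
  by (auto simp: DI_def fun_eq_iff)

text \<open>Of three entries of a decreasing subsequence, two would be openers or two would be closers,
  and the partners of two closers, being openers, come in the same order as the closers.\<close>

lemma nonnesting_no_decreasing_triple:
  assumes \<sigma>: "\<sigma> \<in> DI n" and "nonnesting \<sigma>"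
    and in_range: "{a, b, c} \<subseteq> {1..n}" and "a < b" "b < c"
  shows "\<not> (\<sigma> c < \<sigma> b \<and> \<sigma> b < \<sigma> a)"
proof
  assume dec: "\<sigma> c < \<sigma> b \<and> \<sigma> b < \<sigma> a"
  have openers: "\<sigma> i < \<sigma> j" if "i < j" "i < \<sigma> i" "j < \<sigma> j" for i j
    using \<open>nonnesting \<sigma>\<close> that by (auto simp: nonnesting_def strict_mono_on_def)
  have closers: "\<sigma> i < \<sigma> j" if "i < j" "\<sigma> i < i" "\<sigma> j < j" for i j
    using openers[of "\<sigma> j" "\<sigma> i"] that DI_D(1)[OF \<sigma>]
    by (metis nat_neq_iff not_less_iff_gr_or_eq)
  have "\<sigma> i < i \<or> i < \<sigma> i" if "i \<in> {a, b, c}" for i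
    using DI_D(2)[OF \<sigma>, of i] that in_range by force
  then show False
    using openers[of a b] openers[of b c] openers[of a c]
      closers[of a b] closers[of b c] closers[of a c] \<open>a < b\<close> \<open>b < c\<close> dec
    by force
qed

lemma DI_avoiding_4321_eq:
  "DI_avoiding n [4, 3, 2, 1] = {\<sigma> \<in> DI n. nonnesting \<sigma>}"
proof -
  have four: "{1..4::nat} = {1, 2, 3, 4}" by auto
  have "contains_pattern n \<sigma> 4 (one_line [4, 3, 2, 1]) \<longleftrightarrow> \<not> nonnesting \<sigma>" if \<sigma>: "\<sigma> \<in> DI n" for \<sigma>
  proof
    assume "contains_pattern n \<sigma> 4 (one_line [4, 3, 2, 1])"
    then obtain i where i: "strict_mono_on {1..4} i" "i ` {1..4} \<subseteq> {1..n}"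
      and ord: "\<forall>a\<in>{1..4}. \<forall>b\<in>{1..4}.
        \<sigma> (i a) < \<sigma> (i b) \<longleftrightarrow> one_line [4, 3, 2, 1] a < one_line [4, 3, 2, 1] b"
      unfolding contains_pattern_def by blast
    have "i 1 < i 2" "i 2 < i 3"
      using i(1) by (auto simp: strict_mono_on_def)
    moreover have "{i 1, i 2, i 3} \<subseteq> {1..n}"
      using i(2) by (simp add: image_subset_iff)
    moreover have "\<sigma> (i 3) < \<sigma> (i 2)" "\<sigma> (i 2) < \<sigma> (i 1)"
      using ord unfolding four by (simp_all add: one_line_def)
    ultimately show "\<not> nonnesting \<sigma>"
      using nonnesting_no_decreasing_triple[OF \<sigma>] by blast
  next
    assume "\<not> nonnesting \<sigma>"
    then obtain i j where ij: "i < j" "i < \<sigma> i" "j < \<sigma> j" "\<sigma> j \<le> \<sigma> i"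
      by (force simp: nonnesting_def strict_mono_on_def)
    have "\<sigma> j \<noteq> \<sigma> i"
      using ij(1) DI_D(1)[OF \<sigma>] by (metis nat_neq_iff)
    then have lt: "\<sigma> j < \<sigma> i" using ij by simp
    have range: "i \<in> {1..n}" "j \<in> {1..n}" "\<sigma> i \<in> {1..n}" "\<sigma> j \<in> {1..n}"
      using ij DI_D(2,3)[OF \<sigma>] by (metis nat_neq_iff)+
    define k where "k = one_line [i, j, \<sigma> j, \<sigma> i]"
    have k: "k 1 = i" "k 2 = j" "k 3 = \<sigma> j" "k 4 = \<sigma> i"
      by (simp_all add: k_def one_line_def)
    have "strict_mono_on {1..4} k"
    proof (rule strict_mono_onI)
      fix r s assume "r \<in> {1..4::nat}" "s \<in> {1..4::nat}" "r < s"
      then show "k r < k s" using ij lt k unfolding four by auto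
    qed
    moreover have "k ` {1..4} \<subseteq> {1..n}"
      using range k unfolding four by simp
    moreover have "\<forall>a\<in>{1..4}. \<forall>b\<in>{1..4}.
        \<sigma> (k a) < \<sigma> (k b) \<longleftrightarrow> one_line [4, 3, 2, 1] a < one_line [4, 3, 2, 1] b"
      using ij lt k DI_D(1)[OF \<sigma>] unfolding four by (simp add: one_line_def)
    ultimately show "contains_pattern n \<sigma> 4 (one_line [4, 3, 2, 1])"
      unfolding contains_pattern_def by blast
  qed
  moreover have len: "length [4, 3, 2, 1 :: nat] = 4" by simp
  ultimately show ?thesis unfolding DI_avoiding_def len by blast
qed

section \<open>The path of a matching\<close>

definition step_word :: "nat \<Rightarrow> (nat \<Rightarrow> nat) \<Rightarrow> (int \<times> int) list" where
  "step_word n \<sigma> = map (\<lambda>i. if i < \<sigma> i then up else down) [1..<Suc n]"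

lemma length_step_word [simp]: "length (step_word n \<sigma>) = n"
  by (simp add: step_word_def)

lemma step_word_nth:
  "i \<in> {1..n} \<Longrightarrow> step_word n \<sigma> ! (i - 1) = (if i < \<sigma> i then up else down)"
  by (auto simp: step_word_def simp del: upt_Suc)

lemma count_list_take:
  "count_list (take j w) x = card {i \<in> {1..length w}. i \<le> j \<and> w ! (i - 1) = x}"
proof (induction j)
  case 0
  have "{i \<in> {1..length w}. i \<le> 0 \<and> w ! (i - 1) = x} = {}" by auto
  then show ?case by simp
next
  case (Suc j)
  let ?A = "\<lambda>j. {i \<in> {1..length w}. i \<le> j \<and> w ! (i - 1) = x}"
  show ?case
  proof (cases "j < length w")
    case True
    have "?A (Suc j) = (if w ! j = x then insert (Suc j) (?A j) else ?A j)"
      using True by (auto simp: le_Suc_eq)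
    moreover have "Suc j \<notin> ?A j" by simp
    ultimately show ?thesis using Suc True by (simp add: take_Suc_conv_app_nth)
  next
    case False
    then have "?A (Suc j) = ?A j" by auto
    then show ?thesis using Suc False by simp
  qed
qed

lemma count_list_step_word:
  assumes \<sigma>: "\<sigma> \<in> DI n"
  shows "count_list (take j (step_word n \<sigma>)) up = card {i. i \<le> j \<and> i < \<sigma> i}"
    and "count_list (take j (step_word n \<sigma>)) down = card {i. i \<le> j \<and> \<sigma> i < i}"
proof -
  have in_range: "i \<in> {1..n} \<longleftrightarrow> i < \<sigma> i \<or> \<sigma> i < i" for i
    unfolding DI_D(2)[OF \<sigma>, symmetric] by linarith
  have "i \<in> {1..n} \<and> i \<le> j \<and> step_word n \<sigma> ! (i - 1) = up \<longleftrightarrow> i \<le> j \<and> i < \<sigma> i" for i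
    using step_word_nth[of i n \<sigma>] in_range[of i] by (cases "i \<in> {1..n}") auto
  then show "count_list (take j (step_word n \<sigma>)) up = card {i. i \<le> j \<and> i < \<sigma> i}"
    unfolding count_list_take length_step_word by presburger
  have "i \<in> {1..n} \<and> i \<le> j \<and> step_word n \<sigma> ! (i - 1) = down \<longleftrightarrow> i \<le> j \<and> \<sigma> i < i" for i
    using step_word_nth[of i n \<sigma>] in_range[of i] by (cases "i \<in> {1..n}") auto
  then show "count_list (take j (step_word n \<sigma>)) down = card {i. i \<le> j \<and> \<sigma> i < i}"
    unfolding count_list_take length_step_word by presburger
qed

text \<open>An arc that closes by position \<open>j\<close> also opens by position \<open>j\<close>, so the path stays above the
  axis; at \<open>j = 2 * h\<close> all arcs are closed.\<close>

lemma step_word_in_dyck_paths: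
  assumes \<sigma>: "\<sigma> \<in> DI (2 * h)"
  shows "step_word (2 * h) \<sigma> \<in> dyck_paths h"
proof -
  let ?w = "step_word (2 * h) \<sigma>"
  have inj: "inj_on \<sigma> A" for A
    by (rule inj_on_inverseI[of _ \<sigma>]) (simp add: DI_D(1)[OF \<sigma>])
  have prefix: "count_list (take j ?w) down \<le> count_list (take j ?w) up" for j
    unfolding count_list_step_word[OF \<sigma>]
    by (rule card_inj_on_le[OF inj]) (auto simp: DI_D(1)[OF \<sigma>])
  have "count_list ?w up \<le> count_list ?w down"
  proof -
    have "card {i. i \<le> 2 * h \<and> i < \<sigma> i} \<le> card {i. i \<le> 2 * h \<and> \<sigma> i < i}"
    proof (rule card_inj_on_le[OF inj])
      show "\<sigma> ` {i. i \<le> 2 * h \<and> i < \<sigma> i} \<subseteq> {i. i \<le> 2 * h \<and> \<sigma> i < i}"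
        using DI_D[OF \<sigma>] by (auto, metis atLeastAtMost_iff nat_neq_iff)
    qed simp
    then show ?thesis
      using count_list_step_word[OF \<sigma>, of "2 * h"] by simp
  qed
  then have "count_list ?w up = count_list ?w down"
    using prefix[of "2 * h"] by simp
  moreover have steps: "set ?w \<subseteq> {up, down}"
    by (auto simp: step_word_def)
  moreover have "count_list ?w up + count_list ?w down = 2 * h"
  proof -
    have "count_list w up + count_list w down = length w" if "set w \<subseteq> {up, down}" for w
      using that by (induction w) auto
    from this[OF steps] show ?thesis by simp
  qed
  ultimately show ?thesis
    using prefix by (simp add: dyck_paths_eq_ballot_words ballot_words_def)
qed

text \<open>At the least point where two such maps differ, the smaller of the two values would have to
  be taken by the other map at an earlier point, where the maps agree.\<close>

lemma strict_mono_on_same_image_eq: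
  fixes f g :: "'a::wellorder \<Rightarrow> 'b::linorder"
  assumes f: "strict_mono_on A f" and g: "strict_mono_on A g" and image: "f ` A = g ` A"
    and "x \<in> A"
  shows "f x = g x"
  using \<open>x \<in> A\<close>
proof (induction x rule: less_induct)
  case (less x)
  have "\<not> f' x < g' x"
    if mono: "strict_mono_on A f'" "strict_mono_on A g'" and "f' ` A = g' ` A"
      and eq: "\<And>y. y < x \<Longrightarrow> y \<in> A \<Longrightarrow> f' y = g' y" for f' g' :: "'a \<Rightarrow> 'b"
  proof
    assume lt: "f' x < g' x"
    obtain y where y: "y \<in> A" "g' y = f' x"
      using \<open>f' ` A = g' ` A\<close> less.prems by (metis imageE imageI)
    have "y < x"
      using strict_mono_on_less[OF mono(2) y(1) less.prems] lt y(2) by simp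
    then show False
      using eq[of y] y strict_mono_onD[OF mono(1) y(1) less.prems] by simp
  qed
  from this[of f g] this[of g f] show ?case
    using f g image less by fastforce
qed

lemma inj_on_step_word: "inj_on (step_word n) {\<sigma> \<in> DI n. nonnesting \<sigma>}"
proof (rule inj_onI)
  fix \<sigma> \<tau> assume "\<sigma> \<in> {\<sigma> \<in> DI n. nonnesting \<sigma>}" "\<tau> \<in> {\<sigma> \<in> DI n. nonnesting \<sigma>}"
    and eq: "step_word n \<sigma> = step_word n \<tau>"
  then have \<sigma>: "\<sigma> \<in> DI n" "nonnesting \<sigma>" and \<tau>: "\<tau> \<in> DI n" "nonnesting \<tau>"
    by simp_all
  have openers_iff: "i < \<sigma> i \<longleftrightarrow> i < \<tau> i" for i
  proof (cases "i \<in> {1..n}")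
    case True
    then show ?thesis
      using eq step_word_nth[OF True, of \<sigma>] step_word_nth[OF True, of \<tau>]
      by (auto split: if_splits)
  next
    case False
    then show ?thesis using DI_D(2)[OF \<sigma>(1), of i] DI_D(2)[OF \<tau>(1), of i] by auto
  qed
  have image: "\<rho> ` {i. i < \<rho> i} = {i \<in> {1..n}. \<not> i < \<rho> i}" if \<rho>: "\<rho> \<in> DI n" for \<rho>
  proof (rule set_eqI, rule iffI)
    fix i assume "i \<in> \<rho> ` {i. i < \<rho> i}"
    then obtain k where "i = \<rho> k" "k < \<rho> k" by blast
    then show "i \<in> {i \<in> {1..n}. \<not> i < \<rho> i}"
      using DI_D[OF \<rho>, of k] by simp
  next
    fix i assume "i \<in> {i \<in> {1..n}. \<not> i < \<rho> i}"
    then have "\<rho> i < \<rho> (\<rho> i)" using DI_D(1,2)[OF \<rho>, of i] by auto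
    then show "i \<in> \<rho> ` {i. i < \<rho> i}"
      using DI_D(1)[OF \<rho>, of i] by (metis imageI mem_Collect_eq)
  qed
  have agree: "\<sigma> i = \<tau> i" if "i < \<sigma> i" for i
  proof (rule strict_mono_on_same_image_eq[of "{i. i < \<sigma> i}" \<sigma> \<tau>])
    show "strict_mono_on {i. i < \<sigma> i} \<sigma>" "strict_mono_on {i. i < \<sigma> i} \<tau>"
      using \<sigma>(2) \<tau>(2) openers_iff by (simp_all add: nonnesting_def)
    show "\<sigma> ` {i. i < \<sigma> i} = \<tau> ` {i. i < \<sigma> i}"
      using image[OF \<sigma>(1)] image[OF \<tau>(1)] openers_iff by simp
  qed (use that in simp)
  show "\<sigma> = \<tau>"
  proof
    fix i
    consider "i < \<sigma> i" | "\<sigma> i < i" | "\<sigma> i = i" by linarith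
    then show "\<sigma> i = \<tau> i"
    proof cases
      case 1
      then show ?thesis by (rule agree)
    next
      case 2
      then have "\<tau> (\<sigma> i) = i" using agree[of "\<sigma> i"] DI_D(1)[OF \<sigma>(1), of i] by simp
      then show ?thesis using DI_D(1)[OF \<tau>(1), of "\<sigma> i"] by simp
    next
      case 3
      then show ?thesis using DI_D(2)[OF \<sigma>(1), of i] DI_D(2)[OF \<tau>(1), of i] by auto
    qed
  qed
qed

section \<open>The matching of a path\<close>

text \<open>If the \<open>k\<close>-th element of \<open>C\<close> came before the \<open>k\<close>-th element of \<open>A\<close>, then up to that
  position \<open>C\<close> would have more elements than \<open>A\<close>.\<close>

lemma enumeration_less_of_ballot:
  fixes a c :: "nat \<Rightarrow> nat"
  assumes a: "bij_betw a {..<h} A" "strict_mono_on {..<h} a"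
    and c: "bij_betw c {..<h} C" "strict_mono_on {..<h} c"
    and disjoint: "A \<inter> C = {}"
    and ballot: "\<And>j. card {i \<in> C. i \<le> j} \<le> card {i \<in> A. i \<le> j}"
    and "k < h"
  shows "a k < c k"
proof (rule ccontr)
  assume "\<not> a k < c k"
  moreover have "a k \<in> A" "c k \<in> C"
    using a(1) c(1) \<open>k < h\<close> by (auto simp: bij_betw_def)
  ultimately have lt: "c k < a k"
    using disjoint by (metis disjoint_iff nat_neq_iff)
  have "{i \<in> A. i \<le> c k} \<subseteq> a ` {..<k}"
  proof
    fix i assume "i \<in> {i \<in> A. i \<le> c k}"
    then obtain m where m: "m < h" "i = a m" "a m \<le> c k"
      using a(1) by (auto simp: bij_betw_def)
    then have "m < k"
      using strict_mono_on_less[OF a(2), of m k] \<open>k < h\<close> lt by simp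
    then show "i \<in> a ` {..<k}" using m by simp
  qed
  then have "card {i \<in> A. i \<le> c k} \<le> k"
    using surj_card_le[of "{..<k}"] by simp
  moreover have "Suc k \<le> card {i \<in> C. i \<le> c k}"
  proof -
    have "c ` {..k} \<subseteq> {i \<in> C. i \<le> c k}"
      using c \<open>k < h\<close> strict_mono_on_leD[OF c(2)] by (auto simp: bij_betw_def)
    moreover have "inj_on c {..k}"
      using c(1) \<open>k < h\<close> by (auto simp: bij_betw_def intro: inj_on_subset)
    ultimately show ?thesis
      using card_mono[of "{i \<in> C. i \<le> c k}" "c ` {..k}"] by (simp add: card_image)
  qed
  ultimately show False using ballot[of "c k"] by simp
qed

text \<open>The \<open>k\<close>-th element of \<open>A\<close> is matched with the \<open>k\<close>-th element of \<open>C\<close>.\<close>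

lemma ex_nonnesting_with_openers:
  assumes union: "A \<union> C = {1..n}" and disjoint: "A \<inter> C = {}" and card: "card A = card C"
    and ballot: "\<And>j. card {i \<in> C. i \<le> j} \<le> card {i \<in> A. i \<le> j}"
  obtains \<sigma> where "\<sigma> \<in> DI n" "nonnesting \<sigma>" "{i. i < \<sigma> i} = A"
proof -
  have fin: "finite A" "finite C"
    using union by (metis finite_Un finite_atLeastAtMost)+
  define h where "h = card A"
  obtain a where a: "bij_betw a {..<h} A" "strict_mono_on {..<h} a"
    using ex_bij_betw_strict_mono_card[OF fin(1)] unfolding h_def by blast
  obtain c where c: "bij_betw c {..<h} C" "strict_mono_on {..<h} c"
    using ex_bij_betw_strict_mono_card[OF fin(2)] unfolding h_def card by blast
  have less: "a k < c k" if "k < h" for k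
    using enumeration_less_of_ballot[OF a c disjoint ballot that] .
  define \<sigma> where "\<sigma> i = (if i \<in> A then c (inv_into {..<h} a i)
      else if i \<in> C then a (inv_into {..<h} c i) else i)" for i
  have in_A: "a k \<in> A" and in_C: "c k \<in> C" if "k < h" for k
    using a(1) c(1) that by (auto simp: bij_betw_def)
  have \<sigma>_a: "\<sigma> (a k) = c k" if "k < h" for k
    using in_A[OF that] that a(1) by (simp add: \<sigma>_def bij_betw_def)
  have \<sigma>_c: "\<sigma> (c k) = a k" if "k < h" for k
  proof -
    have "c k \<notin> A" using in_C[OF that] disjoint by blast
    then show ?thesis using in_C[OF that] that c(1) by (simp add: \<sigma>_def bij_betw_def)
  qed
  have \<sigma>_out: "\<sigma> i = i" if "i \<notin> {1..n}" for i
    using that union by (auto simp: \<sigma>_def)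
  have cases: "(\<exists>k<h. i = a k) \<or> (\<exists>k<h. i = c k) \<or> i \<notin> {1..n}" for i
    using union a(1) c(1) by (auto simp: bij_betw_def)
  have invol: "\<sigma> (\<sigma> i) = i" for i
    using cases[of i] \<sigma>_a \<sigma>_c \<sigma>_out by auto
  have openers: "i < \<sigma> i \<longleftrightarrow> (\<exists>k<h. i = a k)" for i
    using cases[of i] \<sigma>_a \<sigma>_c \<sigma>_out less by (metis less_irrefl order_less_asym)
  have set: "{i. i < \<sigma> i} = A"
    unfolding openers using a(1) by (auto simp: bij_betw_def)
  have "\<sigma> permutes {1..n}"
    unfolding permutes_def using \<sigma>_out invol by metis
  moreover have "\<sigma> i \<noteq> i" if "i \<in> {1..n}" for i
    using cases[of i] that \<sigma>_a \<sigma>_c less by (metis less_irrefl)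
  ultimately have "\<sigma> \<in> DI n"
    using invol by (auto simp: DI_def)
  moreover have "nonnesting \<sigma>"
    unfolding nonnesting_def
  proof (rule strict_mono_onI)
    fix i j assume "i \<in> {i. i < \<sigma> i}" "j \<in> {i. i < \<sigma> i}" "i < j"
    then obtain k m where km: "k < h" "i = a k" "m < h" "j = a m" "a k < a m"
      using openers by auto
    then have "k < m" using strict_mono_on_less[OF a(2), of k m] by simp
    then show "\<sigma> i < \<sigma> j"
      using km \<sigma>_a strict_mono_onD[OF c(2), of k m] by simp
  qed
  ultimately show ?thesis using set that by blast
qed

lemma dyck_path_is_step_word:
  assumes "w \<in> dyck_paths h"
  obtains \<sigma> where "\<sigma> \<in> DI (2 * h)" "nonnesting \<sigma>" "step_word (2 * h) \<sigma> = w"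
proof -
  have w: "set w \<subseteq> {up, down}" "count_list w up = h" "count_list w down = h"
    "\<And>j. count_list (take j w) down \<le> count_list (take j w) up"
    using assms by (auto simp: dyck_paths_eq_ballot_words ballot_words_def)
  have "length w = count_list w up + count_list w down"
    using w(1) by (induction w) auto
  then have len: "length w = 2 * h" using w(2,3) by simp
  define A where "A = {i \<in> {1..2 * h}. w ! (i - 1) = up}"
  define C where "C = {i \<in> {1..2 * h}. w ! (i - 1) = down}"
  have nth: "w ! (i - 1) = up \<or> w ! (i - 1) = down" if "i \<in> {1..2 * h}" for i
  proof -
    have "w ! (i - 1) \<in> set w" using that len by (intro nth_mem) auto
    then show ?thesis using w(1) by blast
  qed
  have count: "count_list (take j w) up = card {i \<in> A. i \<le> j}"
    "count_list (take j w) down = card {i \<in> C. i \<le> j}" for j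
    unfolding count_list_take len A_def C_def by (auto intro!: arg_cong[where f = card])
  have "A \<union> C = {1..2 * h}"
    unfolding A_def C_def using nth by blast
  moreover have "A \<inter> C = {}"
    by (auto simp: A_def C_def)
  moreover have "card A = card C"
  proof -
    have "{i \<in> A. i \<le> 2 * h} = A" "{i \<in> C. i \<le> 2 * h} = C" by (auto simp: A_def C_def)
    then show ?thesis using count[of "2 * h"] w(2,3) len by simp
  qed
  ultimately obtain \<sigma> where \<sigma>: "\<sigma> \<in> DI (2 * h)" "nonnesting \<sigma>" "{i. i < \<sigma> i} = A"
    using ex_nonnesting_with_openers[of A C "2 * h"] w(4) unfolding count by blast
  have "step_word (2 * h) \<sigma> = w"
  proof (rule nth_equalityI)
    fix k assume "k < length (step_word (2 * h) \<sigma>)"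
    then have k: "Suc k \<in> {1..2 * h}" by simp
    have "Suc k < \<sigma> (Suc k) \<longleftrightarrow> Suc k \<in> A"
      using \<sigma>(3) by blast
    then have "Suc k < \<sigma> (Suc k) \<longleftrightarrow> w ! k = up"
      using k by (simp add: A_def)
    then show "step_word (2 * h) \<sigma> ! k = w ! k"
      using step_word_nth[OF k, of \<sigma>] nth[OF k] by auto
  qed (simp add: len)
  with \<sigma> that show ?thesis by blast
qed

theorem theorem10:
  fixes h :: nat
  assumes "h \<ge> 1"
  shows "(\<exists>f. bij_betw f (DI_avoiding (2 * h) [4, 3, 2, 1]) (dyck_paths h)) \<and>
         card (DI_avoiding (2 * h) [4, 3, 2, 1]) = catalan h"
proof -
  have "step_word (2 * h) ` {\<sigma> \<in> DI (2 * h). nonnesting \<sigma>} = dyck_paths h"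
  proof
    show "step_word (2 * h) ` {\<sigma> \<in> DI (2 * h). nonnesting \<sigma>} \<subseteq> dyck_paths h"
      using step_word_in_dyck_paths by blast
    show "dyck_paths h \<subseteq> step_word (2 * h) ` {\<sigma> \<in> DI (2 * h). nonnesting \<sigma>}"
    proof
      fix w assume "w \<in> dyck_paths h"
      then show "w \<in> step_word (2 * h) ` {\<sigma> \<in> DI (2 * h). nonnesting \<sigma>}"
        by (rule dyck_path_is_step_word) blast
    qed
  qed
  then have "bij_betw (step_word (2 * h)) (DI_avoiding (2 * h) [4, 3, 2, 1]) (dyck_paths h)"
    unfolding DI_avoiding_4321_eq bij_betw_def using inj_on_step_word by blast
  then show ?thesis
    using bij_betw_same_card card_dyck_paths by metis
qed

end
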